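(* Let $(\lambda_n^b)_{n\ge 0}$ be positive numbers with $1+\sum_{i=0}^\infty\lambda_0^b\lambda_1^b\cdots\lambda_i^b<\infty$, and let $b(n,\boldsymbol{\theta})$ be the corresponding stationary (base) distribution. Let $\mathcal{F}=\{n_0,\dots,n_m\}\subseteq\{0,1,\dots,q\}$ with $n_0<n_1<\dots<n_m$, let $0<\varphi_n<\infty$ for $n\in\mathcal{F}$, and put $$\lambda_n=\begin{cases}\dfrac{1}{\varphi_n^{\mathbf{1}_{\mathcal{F}}(n)}}\lambda_n^b,& n=0,1,\dots,q,\\[2mm] \lambda_n^b,&n>q.\end{cases}$$ Then the stationary distribution of the birth-death process with birth-death-rate ratios $\lambda_n$ is $$p(n,\boldsymbol{\theta},\boldsymbol{\varphi})=\frac{\Bigl(\prod_{i=0}^m\varphi_{n_i}^{u_{n_i}(n)}\Bigr)\,b(n,\boldsymbol{\theta})}{z(\boldsymbol{\theta},\boldsymbol{\varphi})},\qquad z(\boldsymbol{\theta},\boldsymbol{\varphi})=1+\sum_{i=0}^m\Bigl(\prod_{j=i}^m\varphi_{n_j}-1\Bigr)\sum_{k=n_{i-1}+1}^{n_i}b(k,\boldsymbol{\theta}),\qquad n=0,1,2,\dots$$ where $\boldsymbol{\varphi}=[\varphi_{n_0},\dots,\varphi_{n_m}]$ and $n_{-1}=-1$.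
   Context: For a birth-death process on $\{0,1,2,\dots\}$ with birth rates $\gamma_n$ ($n\ge0$) and death rates $\mu_n$ ($n\ge1$), the birth-death-rate ratios are $\lambda_n=\gamma_n/\mu_{n+1}>0$. When $1+\sum_{i=0}^\infty\lambda_0\lambda_1\cdots\lambda_i<\infty$, the stationary distribution is $p_0=\bigl(1+\sum_{i=0}^\infty\lambda_0\lambda_1\cdots\lambda_i\bigr)^{-1}$ and $p_n=\lambda_0\lambda_1\cdots\lambda_{n-1}p_0$ for $n>0$. The base distribution $b(n,\boldsymbol{\theta})$ is the one obtained this way from the ratios $\lambda_n^b$ (which depend on a parameter vector $\boldsymbol{\theta}$). Here $\mathbf{1}_{\mathcal{F}}(n)=1$ if $n\in\mathcal{F}$ and $0$ otherwise (when $n\notin\mathcal{F}$, $\varphi_n^{\mathbf{1}_{\mathcal{F}}(n)}$ is read as $1$), and $u_{n_i}(n)=1$ if $n\le n_i$ and $0$ otherwise. *)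

theory Defs
  imports Complex_Main "HOL-Library.Indicator_Function"
begin

(* Infinitesimal generator (Q-matrix) with birth rates \<gamma> n (n \<ge> 0) and death rates \<mu> n (n \<ge> 1);
   the value \<mu> 0 is never used. *)
definition bd_generator :: "(nat \<Rightarrow> real) \<Rightarrow> (nat \<Rightarrow> real) \<Rightarrow> nat \<Rightarrow> nat \<Rightarrow> real" where
  "bd_generator \<gamma> \<mu> i j =
     (if j = Suc i then \<gamma> i
      else if i = Suc j then \<mu> i
      else if i = j then - (\<gamma> i + (if i = 0 then 0 else \<mu> i))
      else 0)"

(* A probability vector \<pi> with \<pi> Q = 0. *)
definition bd_stationary :: "(nat \<Rightarrow> real) \<Rightarrow> (nat \<Rightarrow> real) \<Rightarrow> (nat \<Rightarrow> real) \<Rightarrow> bool" where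
  "bd_stationary \<gamma> \<mu> \<pi> \<longleftrightarrow>
     (\<forall>n. 0 \<le> \<pi> n) \<and> \<pi> sums 1 \<and> (\<forall>j. (\<lambda>i. \<pi> i * bd_generator \<gamma> \<mu> i j) sums 0)"

definition bd_summable :: "(nat \<Rightarrow> real) \<Rightarrow> bool" where
  "bd_summable l \<longleftrightarrow> summable (\<lambda>i. \<Prod>k\<le>i. l k)"

(* The stationary distribution written in terms of the rate ratios l n = \<gamma> n / \<mu> (n + 1);
   meaningful under bd_summable l. *)
definition bd_dist :: "(nat \<Rightarrow> real) \<Rightarrow> nat \<Rightarrow> real" where
  "bd_dist l n = (\<Prod>k<n. l k) * inverse (1 + (\<Sum>i. \<Prod>k\<le>i. l k))"

(* Since x ^ 0 = 1, the value of \<phi> outside F is irrelevant. *)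
definition modified_ratio ::
  "nat set \<Rightarrow> nat \<Rightarrow> (nat \<Rightarrow> real) \<Rightarrow> (nat \<Rightarrow> real) \<Rightarrow> nat \<Rightarrow> real" where
  "modified_ratio F q \<phi> lb n =
     (if n \<le> q then 1 / \<phi> n ^ (indicator F n :: nat) * lb n else lb n)"

definition step_u :: "nat \<Rightarrow> nat \<Rightarrow> nat" where
  "step_u a n = (if n \<le> a then 1 else 0)"

(* n_{i-1} + 1, with the convention n_{-1} = -1. *)
definition block_start :: "(nat \<Rightarrow> nat) \<Rightarrow> nat \<Rightarrow> nat" where
  "block_start ns i = (case i of 0 \<Rightarrow> 0 | Suc j \<Rightarrow> ns j + 1)"

definition norm_z :: "(nat \<Rightarrow> nat) \<Rightarrow> nat \<Rightarrow> (nat \<Rightarrow> real) \<Rightarrow> (nat \<Rightarrow> real) \<Rightarrow> real" where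
  "norm_z ns m \<phi> b =
     1 + (\<Sum>i=0..m. ((\<Prod>j=i..m. \<phi> (ns j)) - 1) * (\<Sum>k=block_start ns i..ns i. b k))"

definition modified_dist ::
  "(nat \<Rightarrow> nat) \<Rightarrow> nat \<Rightarrow> (nat \<Rightarrow> real) \<Rightarrow> (nat \<Rightarrow> real) \<Rightarrow> nat \<Rightarrow> real" where
  "modified_dist ns m \<phi> b n =
     (\<Prod>i=0..m. \<phi> (ns i) ^ step_u (ns i) n) * b n / norm_z ns m \<phi> b"

end

(* The net flow across each edge n -- n+1 must vanish, so a stationary vector is determined up to
   scale by the ratios: it is proportional to the products of the first n ratios.  Passing from lb to
   lam divides the n-th product by the \<phi> x with x \<in> F and x < n; up to the constant \<Prod>x\<in>F. \<phi> x this
   multiplies it by the weight w n = \<Prod>{\<phi> x | x \<in> F, n \<le> x}.  This weight is constant on each of the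
   blocks n_{i-1} < n \<le> n_i and equal to 1 beyond n_m, so \<Sum>n. w n * b n differs from
   \<Sum>n. b n = 1 by a finite sum that regroups block by block into z - 1. *)
theory Submission
  imports Defs
begin

text \<open>The leading 1 is the empty product at \<open>n = 0\<close>; the series in
  \<open>bd_summable\<close> starts with the one-factor product.\<close>

lemma bd_weights_sums:
  assumes "bd_summable l"
  shows "(\<lambda>n. \<Prod>k<n. l k) sums (1 + (\<Sum>i. \<Prod>k\<le>i. l k))"
proof -
  have "(\<lambda>i. \<Prod>k<Suc i. l k) sums (\<Sum>i. \<Prod>k\<le>i. l k)"
    using assms unfolding bd_summable_def lessThan_Suc_atMost by (rule summable_sums)
  from sums_Suc[OF this] show ?thesis
    by (simp add: add.commute)
qed

lemma bd_normalizer_pos: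
  assumes "bd_summable l" "\<And>n. 0 < l n"
  shows "0 < 1 + (\<Sum>i. \<Prod>k\<le>i. l k)"
proof -
  have "0 \<le> (\<Sum>i. \<Prod>k\<le>i. l k)"
    using assms unfolding bd_summable_def by (intro suminf_nonneg prod_nonneg ballI less_imp_le)
  then show ?thesis by simp
qed

lemma bd_dist_sums:
  assumes "bd_summable l" "\<And>n. 0 < l n"
  shows "bd_dist l sums 1"
proof -
  have "(\<lambda>n. (\<Prod>k<n. l k) * inverse (1 + (\<Sum>i. \<Prod>k\<le>i. l k))) sums
      ((1 + (\<Sum>i. \<Prod>k\<le>i. l k)) * inverse (1 + (\<Sum>i. \<Prod>k\<le>i. l k)))"
    by (intro sums_mult2 bd_weights_sums assms)
  moreover have "1 + (\<Sum>i. \<Prod>k\<le>i. l k) \<noteq> 0"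
    using bd_normalizer_pos[OF assms] by simp
  ultimately show ?thesis
    by (simp add: bd_dist_def[abs_def])
qed

text \<open>Summing the product form shows that \<open>s\<close> carries the same factor
  \<open>p 0\<close> as every entry, so the scale cancels. Leaving the scale free serves both
  stationary vectors (\<open>s = 1\<close>) and the unnormalised reweighting of
  \<open>b\<close>.\<close>

lemma bd_dist_eqI:
  assumes l: "bd_summable l"
    and p: "\<And>n. p n = (\<Prod>k<n. l k) * p 0" "p sums s" "p 0 \<noteq> 0"
  shows "bd_dist l n = p n / s"
proof -
  have "(\<lambda>n. (\<Prod>k<n. l k) * p 0) sums ((1 + (\<Sum>i. \<Prod>k\<le>i. l k)) * p 0)"
    by (intro sums_mult2 bd_weights_sums l)
  then have "s = (1 + (\<Sum>i. \<Prod>k\<le>i. l k)) * p 0"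
    using p(2) sums_unique2 p(1) by (metis (no_types, lifting) ext)
  then show ?thesis
    using p(1)[of n] p(3) by (simp add: bd_dist_def divide_inverse)
qed

text \<open>\<open>d n\<close> is the net flow from state \<open>n + 1\<close> down to
  \<open>n\<close>. State \<open>j\<close> gains across its upper edge and loses across its lower
  one; state 0 has no lower edge.\<close>

lemma bd_generator_column_sums:
  fixes \<gamma> \<mu> \<pi> :: "nat \<Rightarrow> real"
  defines "d \<equiv> \<lambda>n. \<mu> (Suc n) * \<pi> (Suc n) - \<gamma> n * \<pi> n"
  shows "(\<lambda>i. \<pi> i * bd_generator \<gamma> \<mu> i j) sums (d j - (case j of 0 \<Rightarrow> 0 | Suc k \<Rightarrow> d k))"
proof -
  \<comment> \<open>For \<open>j = 0\<close> truncated subtraction makes \<open>j - 1\<close> equal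
    to \<open>j\<close>, so the set of relevant rows shrinks to 0 and 1.\<close>
  have "(\<lambda>i. \<pi> i * bd_generator \<gamma> \<mu> i j) sums
      (\<Sum>i\<in>{j - 1, j, Suc j}. \<pi> i * bd_generator \<gamma> \<mu> i j)"
    by (rule sums_finite) (auto simp: bd_generator_def)
  also have "(\<Sum>i\<in>{j - 1, j, Suc j}. \<pi> i * bd_generator \<gamma> \<mu> i j) =
      d j - (case j of 0 \<Rightarrow> 0 | Suc k \<Rightarrow> d k)"
    by (cases j) (simp_all add: bd_generator_def d_def algebra_simps)
  finally show ?thesis .
qed

text \<open>Vanishing columns make the net flow the same across all edges, and column 0 forces it to
  be 0.\<close>

lemma bd_generator_invariant_iff:
  "(\<forall>j. (\<lambda>i. \<pi> i * bd_generator \<gamma> \<mu> i j) sums 0) \<longleftrightarrow>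
    (\<forall>n. \<mu> (Suc n) * \<pi> (Suc n) = \<gamma> n * \<pi> n)"
  (is "?invariant \<longleftrightarrow> ?balance")
proof -
  define d where "d n = \<mu> (Suc n) * \<pi> (Suc n) - \<gamma> n * \<pi> n" for n
  have col: "(\<lambda>i. \<pi> i * bd_generator \<gamma> \<mu> i j) sums (d j - (case j of 0 \<Rightarrow> 0 | Suc k \<Rightarrow> d k))"
    for j unfolding d_def by (rule bd_generator_column_sums)
  have "(\<lambda>i. \<pi> i * bd_generator \<gamma> \<mu> i j) sums 0 \<longleftrightarrow> d j = (case j of 0 \<Rightarrow> 0 | Suc k \<Rightarrow> d k)" for j
    using col[of j] sums_unique2[OF col[of j], of 0] by auto
  then have "?invariant \<longleftrightarrow> (\<forall>j. d j = (case j of 0 \<Rightarrow> 0 | Suc k \<Rightarrow> d k))"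
    by (rule arg_cong[where f = All, OF ext])
  also have "\<dots> \<longleftrightarrow> (\<forall>n. d n = 0)"
  proof
    assume *: "\<forall>j. d j = (case j of 0 \<Rightarrow> 0 | Suc k \<Rightarrow> d k)"
    have "d n = 0" for n
    proof (induction n)
      case 0
      show ?case using *[rule_format, of 0] by simp
    next
      case (Suc n)
      then show ?case using *[rule_format, of "Suc n"] by simp
    qed
    then show "\<forall>n. d n = 0" ..
  qed (simp split: nat.split)
  finally show ?thesis by (simp add: d_def)
qed

lemma bd_balance_iff:
  fixes \<gamma> \<mu> l \<pi> :: "nat \<Rightarrow> real"
  assumes "\<And>n. 1 \<le> n \<Longrightarrow> 0 < \<mu> n" "\<And>n. \<gamma> n / \<mu> (n + 1) = l n"
  shows "(\<forall>n. \<mu> (Suc n) * \<pi> (Suc n) = \<gamma> n * \<pi> n) \<longleftrightarrow> (\<forall>n. \<pi> n = (\<Prod>k<n. l k) * \<pi> 0)"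
  (is "?balance \<longleftrightarrow> ?product")
proof -
  have "\<mu> (Suc n) \<noteq> 0" for n
    using assms(1)[of "Suc n"] by simp
  then have "\<mu> (Suc n) * \<pi> (Suc n) = \<gamma> n * \<pi> n \<longleftrightarrow> \<pi> (Suc n) = l n * \<pi> n" for n
    by (simp add: assms(2)[symmetric] field_simps)
  then have "?balance \<longleftrightarrow> (\<forall>n. \<pi> (Suc n) = l n * \<pi> n)" by simp
  also have "\<dots> \<longleftrightarrow> ?product"
  proof
    assume step: "\<forall>n. \<pi> (Suc n) = l n * \<pi> n"
    have "\<pi> n = (\<Prod>k<n. l k) * \<pi> 0" for n
      by (induction n) (simp_all add: step)
    then show ?product ..
  next
    assume *: ?product
    show "\<forall>n. \<pi> (Suc n) = l n * \<pi> n"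
    proof
      fix n
      show "\<pi> (Suc n) = l n * \<pi> n"
        using *[rule_format, of n] *[rule_format, of "Suc n"] by simp
    qed
  qed
  finally show ?thesis .
qed

lemma bd_stationary_iff_bd_dist:
  fixes \<gamma> \<mu> l \<pi> :: "nat \<Rightarrow> real"
  assumes l: "bd_summable l" "\<And>n. 0 < l n"
    and rates: "\<And>n. 1 \<le> n \<Longrightarrow> 0 < \<mu> n" "\<And>n. \<gamma> n / \<mu> (n + 1) = l n"
  shows "bd_stationary \<gamma> \<mu> \<pi> \<longleftrightarrow> (\<forall>n. \<pi> n = bd_dist l n)"
proof
  assume "bd_stationary \<gamma> \<mu> \<pi>"
  then have "\<pi> sums 1" and prod: "\<pi> n = (\<Prod>k<n. l k) * \<pi> 0" for n
    using bd_balance_iff[of \<mu> \<gamma> l, OF rates]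
    unfolding bd_stationary_def bd_generator_invariant_iff by blast+
  \<comment> \<open>Otherwise the product form makes the whole vector zero, against total mass
    1.\<close>
  have "\<pi> 0 \<noteq> 0"
  proof
    assume "\<pi> 0 = 0"
    have "\<pi> n = 0" for n
      by (subst prod) (simp add: \<open>\<pi> 0 = 0\<close>)
    then have "\<pi> = (\<lambda>_. 0)" by (rule ext)
    with \<open>\<pi> sums 1\<close> have "(\<lambda>_. 0 :: real) sums 1" by simp
    with sums_zero show False using sums_unique2 zero_neq_one by blast
  qed
  then show "\<forall>n. \<pi> n = bd_dist l n"
    using bd_dist_eqI[OF l(1) prod \<open>\<pi> sums 1\<close>] by (metis div_by_1)
next
  assume "\<forall>n. \<pi> n = bd_dist l n"
  then have \<pi>: "\<pi> = bd_dist l" by blast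
  have "0 \<le> \<pi> n" for n
    using bd_normalizer_pos[OF l] l(2) unfolding \<pi> bd_dist_def
    by (intro mult_nonneg_nonneg prod_nonneg) (auto intro: less_imp_le)
  moreover have "\<forall>n. \<pi> n = (\<Prod>k<n. l k) * \<pi> 0"
    unfolding \<pi> by (simp add: bd_dist_def)
  ultimately show "bd_stationary \<gamma> \<mu> \<pi>"
    using bd_dist_sums[OF l, folded \<pi>] bd_balance_iff[of \<mu> \<gamma> l, OF rates]
    unfolding bd_stationary_def bd_generator_invariant_iff by blast
qed

text \<open>Since \<open>ns\<close> increases strictly, each block begins right after the previous
  one ends, and the first begins at 0: the blocks tile the range up to \<open>ns m\<close>.\<close>

lemma sum_blocks:
  fixes f :: "nat \<Rightarrow> real"
  assumes "strict_mono_on {0..m} ns"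
  shows "(\<Sum>i=0..m. \<Sum>k=block_start ns i..ns i. f k) = (\<Sum>k\<le>ns m. f k)"
  using assms
proof (induction m)
  case 0
  then show ?case by (simp add: block_start_def atLeast0AtMost)
next
  case (Suc m)
  have "strict_mono_on {0..m} ns"
    using Suc.prems by (rule monotone_on_subset) auto
  then have IH: "(\<Sum>i=0..m. \<Sum>k=block_start ns i..ns i. f k) = (\<Sum>k\<le>ns m. f k)"
    by (rule Suc.IH)
  have "ns m < ns (Suc m)"
    using Suc.prems by (auto intro: strict_mono_onD)
  then have "{..ns (Suc m)} = {..ns m} \<union> {Suc (ns m)..ns (Suc m)}" by auto
  then have "(\<Sum>k\<le>ns (Suc m). f k) = (\<Sum>k\<le>ns m. f k) + (\<Sum>k=Suc (ns m)..ns (Suc m). f k)"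
    by (simp only:) (rule sum.union_disjoint, auto)
  with IH show ?case by (simp add: block_start_def)
qed

text \<open>Inside block \<open>i\<close>, exactly the indices \<open>j \<ge> i\<close> have
  exponent 1.\<close>

lemma prod_step_u_block:
  fixes \<phi> :: "nat \<Rightarrow> real"
  assumes ns: "strict_mono_on {0..m} ns"
    and i: "i \<in> {0..m}" and k: "k \<in> {block_start ns i..ns i}"
  shows "(\<Prod>j=0..m. \<phi> (ns j) ^ step_u (ns j) k) = (\<Prod>j=i..m. \<phi> (ns j))"
proof -
  have mono: "ns a \<le> ns c" if "a \<le> c" "c \<le> m" for a c
    using strict_mono_onD[OF ns, of a c] that by (cases "a = c") auto
  have "k \<le> ns j \<longleftrightarrow> i \<le> j" if j: "j \<le> m" for j
  proof
    assume "i \<le> j"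
    then show "k \<le> ns j" using mono[of i j] j k by simp
  next
    assume "k \<le> ns j"
    show "i \<le> j"
    proof (rule ccontr)
      assume "\<not> i \<le> j"
      \<comment> \<open>Block \<open>i\<close> starts beyond \<open>ns h\<close>, which is at least
        \<open>ns j\<close>.\<close>
      then obtain h where h: "i = Suc h" "j \<le> h" by (cases i) auto
      then show False using \<open>k \<le> ns j\<close> mono[of j h] i k by (simp add: block_start_def)
    qed
  qed
  then have "(\<Prod>j=0..m. \<phi> (ns j) ^ step_u (ns j) k) = (\<Prod>j=0..m. if i \<le> j then \<phi> (ns j) else 1)"
    by (intro prod.cong) (auto simp: step_u_def)
  also have "\<dots> = (\<Prod>j\<in>{j \<in> {0..m}. i \<le> j}. \<phi> (ns j))"
    by (rule prod.inter_filter[symmetric]) simp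
  also have "{j \<in> {0..m}. i \<le> j} = {i..m}" by auto
  finally show ?thesis .
qed

lemma norm_z_sums:
  fixes \<phi> b :: "nat \<Rightarrow> real"
  assumes ns: "strict_mono_on {0..m} ns" and b: "b sums 1"
  shows "(\<lambda>n. (\<Prod>i=0..m. \<phi> (ns i) ^ step_u (ns i) n) * b n) sums norm_z ns m \<phi> b"
proof -
  define w where "w n = (\<Prod>i=0..m. \<phi> (ns i) ^ step_u (ns i) n)" for n
  have "w n = 1" if "n > ns m" for n
  proof -
    have lt: "ns i < n" if "i \<le> m" for i
      using strict_mono_onD[OF ns, of i m] that \<open>n > ns m\<close> by (cases "i = m") auto
    have "step_u (ns i) n = 0" if "i \<le> m" for i
      using lt[OF that] by (simp add: step_u_def)
    then show ?thesis unfolding w_def by (intro prod.neutral) simp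
  qed
  \<comment> \<open>Splitting \<open>w\<close> as 1 plus \<open>w - 1\<close> leaves a finitely
    supported correction, so convergence is inherited from \<open>b\<close>.\<close>
  then have "(\<lambda>n. (w n - 1) * b n) sums (\<Sum>n\<le>ns m. (w n - 1) * b n)"
    by (intro sums_finite) auto
  from sums_add[OF b this] have "(\<lambda>n. w n * b n) sums (1 + (\<Sum>n\<le>ns m. (w n - 1) * b n))"
    by (simp add: algebra_simps)
  also have "1 + (\<Sum>n\<le>ns m. (w n - 1) * b n) = norm_z ns m \<phi> b"
    unfolding norm_z_def sum_blocks[OF ns, symmetric] sum_distrib_left w_def
    by (intro arg_cong2[of _ _ _ _ "(+)"] refl sum.cong) (simp only: prod_step_u_block[OF ns])
  finally show ?thesis unfolding w_def .
qed

text \<open>Between \<open>n\<close> and \<open>n + 1\<close> only the step located at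
  \<open>n\<close> switches off, so at most the factor \<open>\<phi> n\<close> is lost.\<close>

lemma prod_step_u_Suc:
  fixes \<phi> :: "nat \<Rightarrow> real" and ns :: "nat \<Rightarrow> nat"
  assumes "strict_mono_on {0..m} ns"
  shows "(\<Prod>i=0..m. \<phi> (ns i) ^ step_u (ns i) n) =
    \<phi> n ^ indicator (ns ` {0..m}) n * (\<Prod>i=0..m. \<phi> (ns i) ^ step_u (ns i) (Suc n))"
proof -
  let ?F = "ns ` {0..m}"
  \<comment> \<open>Reindexing by the points of \<open>F\<close> avoids searching for the index
    \<open>i\<close> with \<open>ns i = n\<close>.\<close>
  have w: "(\<Prod>i=0..m. \<phi> (ns i) ^ step_u (ns i) k) = (\<Prod>x\<in>?F. \<phi> x ^ step_u x k)" for k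
    using strict_mono_on_imp_inj_on[OF assms] by (simp add: prod.reindex)
  have "(\<Prod>x\<in>?F. \<phi> x ^ step_u x n) =
      (\<Prod>x\<in>?F. (if x = n then \<phi> n else 1) * \<phi> x ^ step_u x (Suc n))"
    by (intro prod.cong) (auto simp: step_u_def)
  also have "\<dots> = (if n \<in> ?F then \<phi> n else 1) * (\<Prod>x\<in>?F. \<phi> x ^ step_u x (Suc n))"
    by (simp add: prod.distrib prod.delta del: image_iff)
  also have "(if n \<in> ?F then \<phi> n else 1) = \<phi> n ^ indicator ?F n"
    by (simp add: indicator_def)
  finally show ?thesis unfolding w .
qed

theorem mainTheorem3:
  fixes lb \<phi> \<gamma> \<mu> lam b :: "nat \<Rightarrow> real"
    and ns :: "nat \<Rightarrow> nat" and m q :: nat and F :: "nat set"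
  assumes "\<And>n. 0 < lb n"
    and "bd_summable lb"
    and "b = bd_dist lb"
    and "strict_mono_on {0..m} ns"
    and "F = ns ` {0..m}"
    and "F \<subseteq> {0..q}"
    and "\<And>n. n \<in> F \<Longrightarrow> 0 < \<phi> n"
    and "lam = modified_ratio F q \<phi> lb"
    and "\<And>n. 0 < \<gamma> n"
    and "\<And>n. 1 \<le> n \<Longrightarrow> 0 < \<mu> n"
    and "\<And>n. \<gamma> n / \<mu> (n + 1) = lam n"
  shows "bd_summable lam
    \<and> (\<forall>n. bd_dist lam n = modified_dist ns m \<phi> b n)
    \<and> (\<forall>\<pi>. bd_stationary \<gamma> \<mu> \<pi> \<longleftrightarrow> (\<forall>n. \<pi> n = modified_dist ns m \<phi> b n))"
proof -
  define w where "w n = (\<Prod>i=0..m. \<phi> (ns i) ^ step_u (ns i) n)" for n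
  define c where "c = inverse (1 + (\<Sum>i. \<Prod>k\<le>i. lb k))"
  note lb_pos = assms(1) and ns = assms(4)
  have c: "c > 0" using bd_normalizer_pos[OF assms(2) lb_pos] by (simp add: c_def)
  have \<phi>_pow: "0 < \<phi> n ^ (indicator F n :: nat)" for n
    using assms(7) by (simp add: indicator_def)
  \<comment> \<open>Beyond \<open>q\<close> the indicator vanishes because \<open>F\<close> lies in
    \<open>{0..q}\<close>, so one formula covers both branches.\<close>
  have lam: "lam n = lb n / \<phi> n ^ (indicator F n :: nat)" for n
    using assms(6) by (auto simp: assms(8) modified_ratio_def indicator_def)
  have lam_pos: "0 < lam n" for n
    using lb_pos \<phi>_pow by (simp add: lam)
  have w0: "w 0 > 0" using assms(5,7) by (auto simp: w_def intro!: prod_pos)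
  have w_Suc: "w (Suc n) * lb n = w n * lam n" for n
    using prod_step_u_Suc[OF ns, of \<phi> n] less_imp_neq[OF \<phi>_pow[of n]]
    by (simp add: w_def lam flip: assms(5) del: power_eq_0_iff)
  have w_prod: "w n * (\<Prod>k<n. lb k) = (\<Prod>k<n. lam k) * w 0" for n
  proof (induction n)
    case (Suc n)
    have "w (Suc n) * (\<Prod>k<Suc n. lb k) = (w (Suc n) * lb n) * (\<Prod>k<n. lb k)" by simp
    also have "\<dots> = (w n * (\<Prod>k<n. lb k)) * lam n" by (simp add: w_Suc)
    also have "\<dots> = (\<Prod>k<Suc n. lam k) * w 0" by (simp add: Suc.IH)
    finally show ?case .
  qed simp
  have b: "b n = (\<Prod>k<n. lb k) * c" for n
    by (simp add: assms(3) bd_dist_def c_def)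
  \<comment> \<open>The reweighted base distribution thus has the product form for the ratios
    \<open>lam\<close>, with initial value \<open>w 0 * b 0\<close>.\<close>
  have wb: "w n * b n = (\<Prod>k<n. lam k) * (w 0 * b 0)" for n
    using w_prod[of n] by (simp add: b)
  have wb0: "w 0 * b 0 \<noteq> 0" using w0 c by (simp add: b)
  have wb_sums: "(\<lambda>n. w n * b n) sums norm_z ns m \<phi> b"
    using norm_z_sums[OF ns] bd_dist_sums[OF assms(2) lb_pos] by (simp add: w_def assms(3))
  \<comment> \<open>Summability for \<open>lam\<close> is read off from the convergent series of
    \<open>w n * b n\<close>, a nonzero multiple of the products of \<open>lam\<close>.\<close>
  then have "summable (\<lambda>n. (\<Prod>k<n. lam k) * (w 0 * b 0))"
    by (simp only: wb[symmetric] sums_summable)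
  then have "summable (\<lambda>n. \<Prod>k<n. lam k)"
    using wb0 summable_mult_D[of "w 0 * b 0"] by (simp add: mult.commute)
  then have "summable (\<lambda>n. \<Prod>k<Suc n. lam k)"
    by (subst summable_Suc_iff)
  then have summ: "bd_summable lam"
    by (simp only: bd_summable_def lessThan_Suc_atMost)
  have dist: "bd_dist lam n = modified_dist ns m \<phi> b n" for n
    using bd_dist_eqI[OF summ wb wb_sums wb0] by (simp add: modified_dist_def w_def)
  show ?thesis
    using summ dist bd_stationary_iff_bd_dist[of lam \<mu> \<gamma>, OF summ lam_pos assms(10,11)] by simp
qed

end
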